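(* Let $\lambda\in\mathbb{R}$, let $y,z\in\mathbb{C}$ with $z\ne0$, let $r\in\mathbb{Z}$, and let $f_{\lambda}(t)=\sum_{k=0}^{\infty}a_{k}(t)_{k,\lambda}$ be a degenerate formal power series. Then $$\sum_{n=0}^{\infty}\frac{1}{(n+1)^{r}}\bigg\{\sum_{k=0}^{n}\binom{n}{k}(-1)^{k}f_{\lambda}(y+zk)\bigg\}= \sum_{m=0}^{\infty}a_{m}(-1)^{m}z^{m}\beta_{m,\frac{\lambda}{z}}^{(r)}\bigg(\frac{y}{z}\bigg).$$ In particular, for $y=0$, $$\sum_{n=0}^{\infty}\frac{1}{(n+1)^{r}}\bigg\{\sum_{k=0}^{n}\binom{n}{k}(-1)^{k}f_{\lambda}(zk)\bigg\}= \sum_{m=0}^{\infty}a_{m}(-1)^{m}z^{m}\beta_{m,\frac{\lambda}{z}}^{(r)}.$$ Both identities are understood formally in the coefficients $a_m$, i.e. for each $m\ge 0$ the coefficients of $a_m$ on the two sides are equal.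
   Context: For a complex number $\mu$, the $\mu$-falling factorials are $(x)_{0,\mu}=1$ and $(x)_{n,\mu}=x(x-\mu)(x-2\mu)\cdots(x-(n-1)\mu)$ for $n\ge1$. The degenerate exponentials are the formal power series $e_{\mu}^{x}(t)=\sum_{n=0}^{\infty}\frac{(x)_{n,\mu}}{n!}t^{n}$ and $e_\mu(t)=e_\mu^1(t)$. For $k\in\mathbb{Z}$, the polylogarithm is $\mathrm{Li}_{k}(x)=\sum_{n=1}^{\infty}\frac{x^{n}}{n^{k}}$. The degenerate poly-Bernoulli polynomials $\beta_{n,\mu}^{(k)}(x)$ are defined, as formal power series in $t$, by $$\frac{\mathrm{Li}_{k}(1-e_{\mu}(-t))}{1-e_{\mu}(-t)}e_{\mu}^{x}(-t)=\sum_{n=0}^{\infty}\beta_{n,\mu}^{(k)}(x)\frac{t^{n}}{n!},$$ and $\beta_{n,\mu}^{(k)}=\beta_{n,\mu}^{(k)}(0)$ are the degenerate poly-Bernoulli numbers. A degenerate formal power series is an expression $f_{\lambda}(t)=\sum_{k=0}^{\infty}a_{k}(t)_{k,\lambda}$ with coefficients $a_0,a_1,a_2,\dots$; for a number $w$, $f_\lambda(w)$ denotes the formal sum $\sum_{m=0}^{\infty}a_m (w)_{m,\lambda}$. Each side of an identity is regarded as a formal linear combination $\sum_{m\ge0}a_m c_m$ with $c_m\in\mathbb{C}$; the outer sum over $n$ is carried out coefficientwise in the $a_m$ (for each $m$, the coefficient of $a_m$ in the inner braces vanishes for $n>m$, so only finitely many $n$ contribute). *)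

theory Defs
  imports "HOL-Computational_Algebra.Computational_Algebra"
begin

definition dfall :: "complex \<Rightarrow> complex \<Rightarrow> nat \<Rightarrow> complex" where
  "dfall \<mu> x n = (\<Prod>i<n. x - of_nat i * \<mu>)"

definition dexp :: "complex \<Rightarrow> complex \<Rightarrow> complex fps" where
  "dexp \<mu> x = Abs_fps (\<lambda>n. dfall \<mu> x n / fact n)"

text \<open>The substitution of $-t$ for $t$ in a formal power series.\<close>

definition subst_neg :: "complex fps \<Rightarrow> complex fps" where
  "subst_neg f = f oo (- fps_X)"

definition polylog_fps :: "int \<Rightarrow> complex fps" where
  "polylog_fps k = Abs_fps (\<lambda>n. if n = 0 then 0 else 1 / (of_nat n powi k))"

text \<open>The quotient below is an exact division: numerator and denominator both have zero constant
  term, and the denominator has order exactly one (see \<open>polylog_quotient_exact\<close>).\<close>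

definition dpoly_bernoulli_gf :: "complex \<Rightarrow> int \<Rightarrow> complex \<Rightarrow> complex fps" where
  "dpoly_bernoulli_gf \<mu> k x =
     (let u = 1 - subst_neg (dexp \<mu> 1) in (polylog_fps k oo u) / u * subst_neg (dexp \<mu> x))"

definition dpoly_bernoulli :: "nat \<Rightarrow> complex \<Rightarrow> int \<Rightarrow> complex \<Rightarrow> complex" where
  "dpoly_bernoulli n \<mu> k x = fact n * fps_nth (dpoly_bernoulli_gf \<mu> k x) n"

definition dpoly_bernoulli_number :: "nat \<Rightarrow> complex \<Rightarrow> int \<Rightarrow> complex" where
  "dpoly_bernoulli_number n \<mu> k = dpoly_bernoulli n \<mu> k 0"

lemma polylog_quotient_exact:
  fixes \<mu> :: complex and k :: int
  defines "u \<equiv> 1 - subst_neg (dexp \<mu> 1)"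
  shows "subdegree u = 1" and "(polylog_fps k oo u) / u * u = polylog_fps k oo u"
proof -
  have u0: "fps_nth u 0 = 0"
    by (simp add: u_def subst_neg_def dexp_def dfall_def)
  have u1: "fps_nth u 1 = 1"
    by (simp add: u_def subst_neg_def dexp_def dfall_def fps_compose_nth)
  show sd: "subdegree u = 1"
    by (rule subdegreeI) (use u0 u1 in auto)
  have "u dvd (polylog_fps k oo u)"
  proof (cases "polylog_fps k oo u = 0")
    case False
    have "fps_nth (polylog_fps k oo u) 0 = 0"
      by (simp add: polylog_fps_def)
    with False have "subdegree (polylog_fps k oo u) \<ge> 1"
      by (metis One_nat_def Suc_leI gr0I nth_subdegree_nonzero)
    with False sd show ?thesis
      by (metis fps_dvd_iff subdegree_0 zero_neq_one)
  qed simp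
  then show "(polylog_fps k oo u) / u * u = polylog_fps k oo u"
    by simp
qed

text \<open>A formal linear combination $\sum_m a_m c_m$ in the indeterminate coefficients
  $a_0, a_1, \ldots$ is represented by the sequence of its coefficients $m \mapsto c_m$, so that
  equality is equality of the coefficients of every $a_m$.\<close>

type_synonym formal_comb = "nat \<Rightarrow> complex"

text \<open>The value $f_\lambda(w) = \sum_m a_m (w)_{m,\lambda}$ of the general degenerate formal power
  series $f_\lambda(t) = \sum_k a_k (t)_{k,\lambda}$.  Since the $a_m$ are indeterminates, the series
  itself carries no further data.\<close>

definition dfps_at :: "real \<Rightarrow> complex \<Rightarrow> formal_comb" where
  "dfps_at l w = (\<lambda>m. dfall (of_real l) w m)"

text \<open>Coefficientwise summation over \<open>n\<close> of formal linear combinations: for each $m$ only finitely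
  many \<open>F n\<close> may contribute to the coefficient of $a_m$.  No topology on the complex numbers is
  involved.\<close>

definition has_formal_sum :: "(nat \<Rightarrow> formal_comb) \<Rightarrow> formal_comb \<Rightarrow> bool" where
  "has_formal_sum F S \<longleftrightarrow>
     (\<forall>m. finite {n. F n m \<noteq> 0} \<and> (\<Sum>n | F n m \<noteq> 0. F n m) = S m)"

end

theory Submission
  imports Defs
begin

text \<open>The generating function hides the double sum. Dividing \<open>Li\<^sub>r(X)\<close> by \<open>X\<close> leaves
  \<open>P(X) = \<Sum>n. X^n / (n+1)^r\<close>, so with \<open>u = 1 - e\<^sub>\<mu>(-t)\<close> the generating function at \<open>x\<close> is
  \<open>P(u) * e\<^sub>\<mu>^x(-t) = \<Sum>n. 1/(n+1)^r * u^n * e\<^sub>\<mu>^x(-t)\<close>. The binomial theorem and the exponential law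
  \<open>e\<^sub>\<mu>^x * e\<^sub>\<mu>^y = e\<^sub>\<mu>^(x+y)\<close> turn \<open>u^n * e\<^sub>\<mu>^x(-t)\<close> into the alternating sum
  \<open>\<Sum>k\<le>n. (n choose k) (-1)^k e\<^sub>\<mu>^(x+k)(-t)\<close>, whose coefficient at \<open>t^m\<close> is, up to the factor
  \<open>(-1)^m / m!\<close>, the inner brace of the theorem for \<open>\<mu> = \<lambda>/z\<close> and \<open>x = y/z\<close>; the factor
  \<open>z^m\<close> is the homogeneity of falling factorials. As \<open>u\<close> has no constant term, \<open>u^n\<close>
  contributes nothing to \<open>t^m\<close> for \<open>n > m\<close>, which is why each coefficient is a finite sum.

  The mechanism is collected in \<open>one_minus_power_times_dexp_nth\<close> and \<open>dpoly_bernoulli_eq_sum\<close>.\<close>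

lemma dfall_Suc: "dfall \<mu> x (Suc n) = (x - of_nat n * \<mu>) * dfall \<mu> x n"
  by (simp add: dfall_def mult.commute)

lemma dfall_scale: "c ^ n * dfall \<mu> x n = dfall (c * \<mu>) (c * x) n"
  by (induction n) (simp_all add: dfall_def algebra_simps)

lemma dexp_nth_Suc:
  "of_nat (Suc n) * dexp \<mu> x $ Suc n = (x - of_nat n * \<mu>) * dexp \<mu> x $ n"
  by (simp add: dexp_def dfall_Suc field_simps del: of_nat_Suc)

text \<open>The differential equation satisfied by \<open>(1 + \<mu>t)\<^sup>x\<^sup>/\<^sup>\<mu>\<close>, in a form that also covers
  \<open>\<mu> = 0\<close>.\<close>

lemma dexp_ODE: "(1 + fps_const \<mu> * fps_X) * fps_deriv (dexp \<mu> x) = fps_const x * dexp \<mu> x"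
proof (rule fps_ext)
  fix n
  show "((1 + fps_const \<mu> * fps_X) * fps_deriv (dexp \<mu> x)) $ n = (fps_const x * dexp \<mu> x) $ n"
    using dexp_nth_Suc[of n \<mu> x]
    by (cases n) (simp_all add: algebra_simps del: of_nat_Suc)
qed

lemma dexp_ODE_unique:
  assumes "(1 + fps_const \<mu> * fps_X) * fps_deriv f = fps_const x * f" and "f $ 0 = 1"
  shows "f = dexp \<mu> x"
proof (rule fps_ext)
  fix n
  show "f $ n = dexp \<mu> x $ n"
  proof (induction n)
    case 0
    show ?case by (simp add: assms dexp_def dfall_def)
  next
    case (Suc n)
    have "((1 + fps_const \<mu> * fps_X) * fps_deriv f) $ n = (fps_const x * f) $ n"
      by (simp add: assms)
    then have "of_nat (Suc n) * f $ Suc n = (x - of_nat n * \<mu>) * f $ n"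
      by (cases n) (simp_all add: algebra_simps del: of_nat_Suc)
    then have "of_nat (Suc n) * f $ Suc n = of_nat (Suc n) * dexp \<mu> x $ Suc n"
      using Suc dexp_nth_Suc by simp
    then show ?case
      by (simp del: of_nat_Suc)
  qed
qed

text \<open>Both sides solve the same first-order differential equation; comparing coefficients, this is
  the Vandermonde convolution for \<open>\<mu>\<close>-falling factorials.\<close>

lemma dexp_add: "dexp \<mu> (x + y) = dexp \<mu> x * dexp \<mu> y"
proof (rule dexp_ODE_unique[symmetric])
  let ?q = "1 + fps_const \<mu> * fps_X"
  have "?q * fps_deriv (dexp \<mu> x * dexp \<mu> y) =
      dexp \<mu> x * (?q * fps_deriv (dexp \<mu> y)) + (?q * fps_deriv (dexp \<mu> x)) * dexp \<mu> y"
    by (simp add: algebra_simps)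
  also have "\<dots> = dexp \<mu> x * (fps_const y * dexp \<mu> y) + (fps_const x * dexp \<mu> x) * dexp \<mu> y"
    by (simp only: dexp_ODE)
  also have "\<dots> = fps_const (x + y) * (dexp \<mu> x * dexp \<mu> y)"
    by (simp add: algebra_simps flip: fps_const_add)
  finally show "?q * fps_deriv (dexp \<mu> x * dexp \<mu> y) = fps_const (x + y) * (dexp \<mu> x * dexp \<mu> y)" .
qed (simp add: dexp_def dfall_def)

lemma dexp_of_nat_mult: "dexp \<mu> (of_nat k * x) = dexp \<mu> x ^ k"
proof (induction k)
  case 0
  have "dexp \<mu> 0 = 1"
    by (rule dexp_ODE_unique[symmetric]) simp_all
  then show ?case by simp
next
  case (Suc k)
  then show ?case by (simp add: distrib_right dexp_add)
qed

lemma subst_neg_nth: "subst_neg f $ n = (-1) ^ n * f $ n"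
proof -
  have "- fps_X = fps_const (-1) * (fps_X :: complex fps)"
    by (simp flip: fps_const_neg)
  then show ?thesis
    unfolding subst_neg_def by (simp only: fps_compose_linear fps_nth_Abs_fps)
qed

lemma subst_neg_mult: "subst_neg (f * g) = subst_neg f * subst_neg g"
  by (simp add: subst_neg_def fps_compose_mult_distrib)

lemma subst_neg_power: "subst_neg (f ^ n) = subst_neg f ^ n"
  by (simp add: subst_neg_def fps_compose_power)

text \<open>Expand the power binomially; by the exponential law each \<open>e\<^sub>\<mu>(-t)^k\<close> only shifts the
  argument \<open>x\<close> to \<open>x + k\<close>. So multiplication by \<open>u^n\<close> acts as an \<open>n\<close>-th finite difference in \<open>x\<close>.\<close>

lemma one_minus_power_times_dexp_nth:
  "((1 - subst_neg (dexp \<mu> 1)) ^ n * subst_neg (dexp \<mu> x)) $ m =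
    (-1) ^ m / fact m * (\<Sum>k=0..n. of_nat (n choose k) * (-1) ^ k * dfall \<mu> (x + of_nat k) m)"
proof -
  let ?v = "subst_neg (dexp \<mu> 1)"
  have "(1 - ?v) ^ n = (\<Sum>k\<le>n. of_nat (n choose k) * (- ?v) ^ k)"
    using binomial_ring[of "- ?v" 1 n] by simp
  also have "\<dots> = (\<Sum>k=0..n. fps_const (of_nat (n choose k) * (-1) ^ k) * ?v ^ k)"
    by (intro sum.cong) (auto simp: power_minus[of ?v] fps_of_nat fps_const_power[symmetric]
      fps_const_neg[symmetric] fps_const_mult[symmetric]
      simp del: fps_const_power fps_const_neg fps_const_mult)
  finally have expand: "(1 - ?v) ^ n * subst_neg (dexp \<mu> x) =
      (\<Sum>k=0..n. fps_const (of_nat (n choose k) * (-1) ^ k) * (?v ^ k * subst_neg (dexp \<mu> x)))"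
    by (simp add: sum_distrib_right mult.assoc)
  have "?v ^ k * subst_neg (dexp \<mu> x) = subst_neg (dexp \<mu> (x + of_nat k))" for k
    using dexp_of_nat_mult[of \<mu> k 1]
    by (simp add: dexp_add subst_neg_mult subst_neg_power mult.commute)
  then show ?thesis
    unfolding expand by (simp add: fps_sum_nth subst_neg_nth dexp_def sum_distrib_left mult_ac)
qed

lemma power_times_nth_eq_0:
  fixes u w :: "'a :: comm_ring_1 fps"
  assumes "u $ 0 = 0" and "m < n"
  shows "(u ^ n * w) $ m = 0"
  using assms startsby_zero_power_prefix[of u n] by (auto simp: fps_mult_nth intro!: sum.neutral)

lemma fps_compose_times_nth:
  fixes p u w :: "'a :: comm_ring_1 fps"
  assumes "u $ 0 = 0"
  shows "((p oo u) * w) $ m = (\<Sum>n=0..m. p $ n * (u ^ n * w) $ m)"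
proof -
  have "(p oo u) $ i = (\<Sum>n=0..m. p $ n * u ^ n $ i)" if "i \<le> m" for i
    unfolding fps_compose_nth using that startsby_zero_power_prefix[OF assms]
    by (intro sum.mono_neutral_left) auto
  then have "((p oo u) * w) $ m = (\<Sum>i=0..m. \<Sum>n=0..m. p $ n * (u ^ n $ i * w $ (m - i)))"
    by (simp add: fps_mult_nth sum_distrib_right mult.assoc)
  also have "\<dots> = (\<Sum>n=0..m. p $ n * (u ^ n * w) $ m)"
    by (subst sum.swap) (simp add: fps_mult_nth sum_distrib_left)
  finally show ?thesis .
qed

lemma polylog_quotient_eq_compose:
  assumes "u $ 0 = 0" and "u \<noteq> 0"
  shows "(polylog_fps r oo u) / u = Abs_fps (\<lambda>n. 1 / of_nat (n + 1) powi r) oo u"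
proof -
  have "polylog_fps r = fps_X * Abs_fps (\<lambda>n. 1 / of_nat (n + 1) powi r)"
    by (rule fps_ext) (auto simp: polylog_fps_def)
  then have "polylog_fps r oo u = u * (Abs_fps (\<lambda>n. 1 / of_nat (n + 1) powi r) oo u)"
    using assms by (simp add: fps_compose_mult_distrib)
  then show ?thesis
    using assms by simp
qed

text \<open>The constant term of \<open>u\<close> vanishes, so the substitution \<open>P(u)\<close> reaches \<open>t^m\<close> only through its
  first \<open>m + 1\<close> terms. This is the case \<open>z = 1\<close> of the theorem with complex \<open>\<mu>\<close>, which is needed
  because \<open>\<lambda>/z\<close> is in general not real.\<close>

lemma dpoly_bernoulli_eq_sum:
  "dpoly_bernoulli m \<mu> r x = (-1) ^ m * (\<Sum>n=0..m. 1 / of_nat (n + 1) powi r *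
    (\<Sum>k=0..n. of_nat (n choose k) * (-1) ^ k * dfall \<mu> (x + of_nat k) m))"
proof -
  let ?u = "1 - subst_neg (dexp \<mu> 1)"
  have u0: "?u $ 0 = 0"
    by (simp add: subst_neg_nth dexp_def dfall_def)
  have "?u \<noteq> 0"
    using polylog_quotient_exact(1)[of \<mu>] by force
  then show ?thesis
    using u0
    by (simp add: dpoly_bernoulli_def dpoly_bernoulli_gf_def Let_def polylog_quotient_eq_compose
        fps_compose_times_nth one_minus_power_times_dexp_nth sum_distrib_left mult.left_commute
        del: of_nat_Suc)
qed

text \<open>A finite difference of order \<open>n\<close> kills polynomials of degree below \<open>n\<close>, here read off from
  the order of vanishing of \<open>u^n\<close>.\<close>

lemma alternating_sum_dfall_eq_0:
  assumes "m < n"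
  shows "(\<Sum>k=0..n. of_nat (n choose k) * (-1) ^ k * dfall \<mu> (x + of_nat k) m) = 0"
proof -
  have "(1 - subst_neg (dexp \<mu> 1)) $ 0 = 0"
    by (simp add: subst_neg_nth dexp_def dfall_def)
  from power_times_nth_eq_0[OF this assms, of "subst_neg (dexp \<mu> x)"] show ?thesis
    by (simp add: one_minus_power_times_dexp_nth)
qed

lemma has_formal_sumI:
  assumes "\<And>n m. m < n \<Longrightarrow> F n m = 0" and "\<And>m. (\<Sum>n=0..m. F n m) = S m"
  shows "has_formal_sum F S"
  unfolding has_formal_sum_def
proof (intro allI conjI)
  fix m
  have sub: "{n. F n m \<noteq> 0} \<subseteq> {0..m}"
    using assms(1) by (auto simp: not_less[symmetric])
  then show "finite {n. F n m \<noteq> 0}"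
    by (rule finite_subset) simp
  have "(\<Sum>n | F n m \<noteq> 0. F n m) = (\<Sum>n=0..m. F n m)"
    using sub by (intro sum.mono_neutral_left) auto
  then show "(\<Sum>n | F n m \<noteq> 0. F n m) = S m"
    using assms(2) by simp
qed

theorem theorem13:
  fixes l :: real and y z :: complex and r :: int
  assumes "z \<noteq> 0"
  shows "has_formal_sum
           (\<lambda>n m. 1 / (of_nat (n + 1) powi r) *
              (\<Sum>k=0..n. of_nat (n choose k) * (-1) ^ k * dfps_at l (y + z * of_nat k) m))
           (\<lambda>m. (-1) ^ m * z ^ m * dpoly_bernoulli m (of_real l / z) r (y / z))
       \<and> has_formal_sum
           (\<lambda>n m. 1 / (of_nat (n + 1) powi r) *
              (\<Sum>k=0..n. of_nat (n choose k) * (-1) ^ k * dfps_at l (z * of_nat k) m))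
           (\<lambda>m. (-1) ^ m * z ^ m * dpoly_bernoulli_number m (of_real l / z) r)"
proof -
  have main: "has_formal_sum
           (\<lambda>n m. 1 / (of_nat (n + 1) powi r) *
              (\<Sum>k=0..n. of_nat (n choose k) * (-1) ^ k * dfps_at l (w + z * of_nat k) m))
           (\<lambda>m. (-1) ^ m * z ^ m * dpoly_bernoulli m (of_real l / z) r (w / z))" for w
  proof -
    let ?D = "\<lambda>n m. \<Sum>k=0..n. of_nat (n choose k) * (-1) ^ k *
      dfall (of_real l / z) (w / z + of_nat k) m"
    have "dfps_at l (w + z * of_nat k) m = z ^ m * dfall (of_real l / z) (w / z + of_nat k) m" for k m
      using assms by (simp add: dfps_at_def dfall_scale distrib_left)
    then have brace: "(\<Sum>k=0..n. of_nat (n choose k) * (-1) ^ k * dfps_at l (w + z * of_nat k) m) =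
        z ^ m * ?D n m" for n m
      by (simp add: sum_distrib_left mult.left_commute)
    show ?thesis
      unfolding brace
    proof (rule has_formal_sumI)
      fix n m :: nat
      assume "m < n"
      then show "1 / of_nat (n + 1) powi r * (z ^ m * ?D n m) = 0"
        by (simp add: alternating_sum_dfall_eq_0)
    next
      fix m
      have "(-1) ^ m * ((-1) ^ m * a) = a" for a :: complex
        by (simp flip: mult.assoc power_mult_distrib)
      then show "(\<Sum>n=0..m. 1 / of_nat (n + 1) powi r * (z ^ m * ?D n m)) =
          (-1) ^ m * z ^ m * dpoly_bernoulli m (of_real l / z) r (w / z)"
        unfolding dpoly_bernoulli_eq_sum
        by (simp only: sum_distrib_left[of "z ^ m"] mult.assoc mult.left_commute[of "z ^ m"])
    qed
  qed
  from main[of y] main[of 0] show ?thesis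
    by (simp only: dpoly_bernoulli_number_def add_0 div_0)
qed

end
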